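(* $\widehat{\mathbb{Z}_2[\xi]}_L=T_1(\mathbb{Z}_2)$, where $T_1(\mathbb{Z}_2)$ is the Tate algebra in one variable over $\mathbb{Z}_2$.
   Context: $\mathbb{Z}_2$ is the ring of dyadic ($2$-adic) integers, $\mathbb{Q}_2$ its fraction field with dyadic absolute value $|\cdot|_2$. $\mathbb{Z}_2[\xi_1,\dots,\xi_n]$ is graded by $\deg\xi_i=1$. $Jq$ is the $\mathbb{Z}_2$-algebra endomorphism with $Jq(1)=1$, $Jq(\xi_i)=\xi_i+\xi_i^2$. For $k\ge0$, $Jq^k$ is the $\mathbb{Z}_2$-linear map raising degree by $k$ obtained, on each degree $d$, by restricting $Jq$ to degree $d$ and projecting onto degree $d+k$ (extended $\mathbb{Q}_2$-linearly to $\mathbb{Q}_2[\xi_1,\dots,\xi_n]$). The dyadic Steenrod algebra $\mathcal{J}_2$ is the $\mathbb{Z}_2$-algebra generated under composition by the $Jq^k$, $k\ge0$, two elements being equal when they agree as operators on $\mathbb{Z}_2[\xi_1,\dots,\xi_n]$ for every $n$. For a polynomial $f=\sum_J a_J\xi^J$ over $\mathbb{Q}_2$, $\|f\|_2=\max_J|a_J|_2$. The linear transformation norm of $\theta\in\mathcal{J}_2$ is $\|\theta\|_L=\inf\{c\ge0 : \|\theta(f)\|_2\le c\|f\|_2 \text{ for all } f\in\mathbb{Q}_2[\xi_1,\dots,\xi_n]\ (\text{all } n)\}$, and $B_L(0,r)=\{\theta\in\mathcal{J}_2:\|\theta\|_L<r\}$. For $B\subseteq\mathcal{J}_2$ and $M=\mathbb{Z}_2[\xi]$,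 $BM$ is the set of finite sums $\sum_i\theta_i(f_i)$, $\theta_i\in B$, $f_i\in M$. The completion $\widehat{\mathbb{Z}_2[\xi]}_L$ is the inverse limit of the abelian groups $\mathbb{Z}_2[\xi]/B_L(0,\tfrac1{2^k})\mathbb{Z}_2[\xi]$, $k\ge0$, with the natural projections. The Tate algebra is $T_1(\mathbb{Z}_2)=\{\sum_{m\ge0}a_m\xi^m : a_m\in\mathbb{Z}_2,\ |a_m|_2\to0 \text{ as } m\to\infty\}$. *)

theory Defs
  imports
    Complex_Main
    "HOL-Library.Poly_Mapping"
    "HOL-Computational_Algebra.Fraction_Field"
    "HOL-Computational_Algebra.Formal_Power_Series"
    "HOL-Algebra.Coset"
begin

section \<open>The dyadic integers and the dyadic numbers\<close>

text \<open>
  The inverse limit of the rings of integers modulo $2^n$: a dyadic integer is the compatible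
  sequence of its residues, where the \<open>n\<close>-th residue is reduced to the range from $0$ to
  $2^n - 1$.
\<close>

typedef dyadic = "{x :: nat \<Rightarrow> int. \<forall>n. 0 \<le> x n \<and> x n < 2 ^ n \<and> x (Suc n) mod 2 ^ n = x n}"
  morphisms residue Abs_dyadic
  by (rule exI[of _ "\<lambda>_. 0"]) auto

setup_lifting type_definition_dyadic

lemma mod_pow2_Suc: "(a mod 2 ^ Suc n) mod 2 ^ n = (a :: int) mod 2 ^ n"
  by (rule mod_mod_cancel) (simp add: le_imp_power_dvd)

lemma reduce_compatible:
  fixes z :: "nat \<Rightarrow> int"
  assumes "\<And>n. z (Suc n) mod 2 ^ n = z n mod 2 ^ n"
  shows "0 \<le> z n mod 2 ^ n \<and> z n mod 2 ^ n < 2 ^ n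
    \<and> (z (Suc n) mod 2 ^ Suc n) mod 2 ^ n = z n mod 2 ^ n"
  using assms[of n] by (simp only: mod_pow2_Suc) simp

instantiation dyadic :: comm_ring_1
begin

lift_definition zero_dyadic :: dyadic is "\<lambda>_. 0" by simp

lift_definition one_dyadic :: dyadic is "\<lambda>n. 1 mod 2 ^ n"
  using reduce_compatible[of "\<lambda>_. 1"] by blast

lift_definition plus_dyadic :: "dyadic \<Rightarrow> dyadic \<Rightarrow> dyadic" is
  "\<lambda>x y n. (x n + y n) mod 2 ^ n"
  subgoal for x y by (rule reduce_compatible) (metis mod_add_eq)
  done

lift_definition uminus_dyadic :: "dyadic \<Rightarrow> dyadic" is "\<lambda>x n. (- x n) mod 2 ^ n"
  subgoal for x by (rule reduce_compatible) (metis mod_minus_eq)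
  done

lift_definition minus_dyadic :: "dyadic \<Rightarrow> dyadic \<Rightarrow> dyadic" is
  "\<lambda>x y n. (x n - y n) mod 2 ^ n"
  subgoal for x y by (rule reduce_compatible) (metis mod_diff_eq)
  done

lift_definition times_dyadic :: "dyadic \<Rightarrow> dyadic \<Rightarrow> dyadic" is
  "\<lambda>x y n. (x n * y n) mod 2 ^ n"
  subgoal for x y by (rule reduce_compatible) (metis mod_mult_eq)
  done

instance
proof
  fix a b c :: dyadic
  show "a * b * c = a * (b * c)" by transfer (simp add: mod_simps mult.assoc)
  show "a * b = b * a" by transfer (simp add: mult.commute)
  show "1 * a = a"
    by transfer (auto simp: fun_eq_iff mod_simps dest: spec[of _ 0])
  show "a + b + c = a + (b + c)" by transfer (simp add: mod_simps add.assoc)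
  show "a + b = b + a" by transfer (simp add: add.commute)
  show "0 + a = a" by transfer (auto simp: fun_eq_iff)
  show "- a + a = 0" by transfer (simp add: mod_simps)
  show "a - b = a + - b" by transfer (simp add: mod_simps)
  show "(a + b) * c = a * c + b * c" by transfer (simp add: mod_simps distrib_right)
  show "(0 :: dyadic) \<noteq> 1"
    by transfer (auto simp: fun_eq_iff intro!: exI[of _ 1])
qed

end

lemma residue_mod: "m \<le> n \<Longrightarrow> residue x n mod 2 ^ m = residue x m"
proof (induction n rule: dec_induct)
  case base
  show ?case using residue[of x] by simp
next
  case (step n)
  have "residue x (Suc n) mod 2 ^ m = (residue x (Suc n) mod 2 ^ n) mod 2 ^ m"
    by (rule mod_mod_cancel[symmetric]) (simp add: le_imp_power_dvd step.hyps)
  also have "residue x (Suc n) mod 2 ^ n = residue x n" using residue[of x] by simp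
  finally show ?case using step.IH by simp
qed

lemma residue_two_power: "residue (2 ^ k) n = 2 ^ k mod 2 ^ n"
proof (induction k)
  case 0
  show ?case by (simp add: one_dyadic.rep_eq)
next
  case (Suc k)
  have "residue 2 n = 2 mod 2 ^ n"
    by (simp only: one_add_one[symmetric] plus_dyadic.rep_eq one_dyadic.rep_eq mod_add_eq)
  then show ?case using Suc by (simp add: times_dyadic.rep_eq mod_mult_eq)
qed

lemma residue_eq_0_iff: "residue x n = 0 \<longleftrightarrow> 2 ^ n dvd x"
proof
  assume 0: "residue x n = 0"
  have dv: "2 ^ n dvd residue x (n + m)" for m
    using residue_mod[of n "n + m" x] 0 by (simp add: dvd_eq_mod_eq_0)
  define y where "y = (\<lambda>m. residue x (n + m) div 2 ^ n)"
  have yx: "residue x (n + m) = 2 ^ n * y m" for m using dv[of m] by (simp add: y_def)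
  have "0 \<le> y m \<and> y m < 2 ^ m \<and> y (Suc m) mod 2 ^ m = y m" for m
  proof (intro conjI)
    have r: "0 \<le> residue x (n + m)" "residue x (n + m) < 2 ^ (n + m)"
      using residue[of x] by auto
    then show "0 \<le> y m" "y m < 2 ^ m" by (auto simp: yx power_add zero_le_mult_iff)
    have "residue x (n + Suc m) mod 2 ^ (n + m) = residue x (n + m)"
      by (rule residue_mod) simp
    then have "2 ^ n * (y (Suc m) mod 2 ^ m) = 2 ^ n * y m"
      by (simp only: yx power_add mult_mod_right)
    then show "y (Suc m) mod 2 ^ m = y m" by simp
  qed
  then have rep: "residue (Abs_dyadic y) = y" by (simp add: Abs_dyadic_inverse)
  have "residue (2 ^ n * Abs_dyadic y) m = residue x m" for m
  proof -
    have "residue (2 ^ n * Abs_dyadic y) m = (2 ^ n * y m) mod 2 ^ m"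
      by (simp add: times_dyadic.rep_eq residue_two_power rep mod_mult_left_eq)
    also have "\<dots> = residue x m" using residue_mod[of m "n + m" x] by (simp add: yx)
    finally show ?thesis .
  qed
  then have "x = 2 ^ n * Abs_dyadic y"
    by (simp add: residue_inject[symmetric] fun_eq_iff)
  then show "2 ^ n dvd x" by simp
next
  assume "2 ^ n dvd x"
  then show "residue x n = 0" by (auto simp: times_dyadic.rep_eq residue_two_power)
qed

lemma residue_1_dyadic: "residue x 1 = 0 \<or> residue x 1 = 1"
proof -
  have "\<forall>n. 0 \<le> residue x n \<and> residue x n < 2 ^ n" using residue[of x] by blast
  from spec[OF this, of 1] show ?thesis by auto
qed

definition dyadic_val :: "dyadic \<Rightarrow> nat"
  where "dyadic_val x = (GREATEST n. 2 ^ n dvd x)"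

lemma dyadic_val_exists:
  fixes x :: dyadic
  assumes "x \<noteq> 0"
  shows "\<exists>b. \<forall>n. 2 ^ n dvd x \<longrightarrow> n \<le> b"
proof -
  obtain b where b: "residue x b \<noteq> 0"
    using assms by (auto simp: residue_inject[symmetric] fun_eq_iff zero_dyadic.rep_eq)
  have "n \<le> b" if "2 ^ n dvd x" for n
  proof (rule ccontr)
    assume "\<not> n \<le> b"
    then have "2 ^ b dvd x" using that by (meson dvd_trans le_imp_power_dvd nat_le_linear)
    then show False using b by (simp add: residue_eq_0_iff)
  qed
  then show ?thesis by blast
qed

lemma dyadic_val_dvd: "x \<noteq> 0 \<Longrightarrow> 2 ^ dyadic_val x dvd x"
  unfolding dyadic_val_def
  using dyadic_val_exists[of x] GreatestI_nat[of "\<lambda>n. 2 ^ n dvd x" 0] by auto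

lemma dyadic_val_greatest: "x \<noteq> 0 \<Longrightarrow> 2 ^ n dvd x \<Longrightarrow> n \<le> dyadic_val x"
  unfolding dyadic_val_def
  using dyadic_val_exists[of x] Greatest_le_nat[of "\<lambda>n. 2 ^ n dvd x" n] by auto

lemma two_power_cancel_dyadic: "2 ^ k * x = 0 \<Longrightarrow> x = (0 :: dyadic)"
proof -
  assume 0: "2 ^ k * x = 0"
  have "residue x n = 0" for n
  proof -
    have "(2 ^ k * residue x (k + n)) mod 2 ^ (k + n) = 0"
      using arg_cong[OF 0, of "\<lambda>z. residue z (k + n)"]
      by (simp add: times_dyadic.rep_eq residue_two_power zero_dyadic.rep_eq mod_mult_left_eq)
    then have "residue x (k + n) mod 2 ^ n = 0" by (simp add: power_add mult_mod_right[symmetric])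
    then show ?thesis using residue_mod[of n "k + n" x] by simp
  qed
  then show "x = 0" by (simp add: residue_inject[symmetric] fun_eq_iff zero_dyadic.rep_eq)
qed

lemma dyadic_val_decomp:
  assumes "x \<noteq> 0"
  obtains u where "x = 2 ^ dyadic_val x * u" "residue u 1 = 1"
proof -
  obtain u where u: "x = 2 ^ dyadic_val x * u" using dyadic_val_dvd[OF assms] by (elim dvdE)
  have "residue u 1 \<noteq> 0"
  proof
    assume "residue u 1 = 0"
    then have "2 dvd u" by (simp add: residue_eq_0_iff)
    then have "2 ^ Suc (dyadic_val x) dvd x"
      by (subst u) (simp add: mult.commute mult_dvd_mono)
    then show False using dyadic_val_greatest[OF assms] by fastforce
  qed
  then show thesis using that u residue_1_dyadic by blast
qed

lemma odd_dyadic_mult: "residue u 1 = 1 \<Longrightarrow> residue v 1 = 1 \<Longrightarrow> residue (u * v) 1 = 1"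
  by (simp add: times_dyadic.rep_eq)

instance dyadic :: idom
proof
  fix x y :: dyadic
  assume "x \<noteq> 0" "y \<noteq> 0"
  then obtain u v where x: "x = 2 ^ dyadic_val x * u" and y: "y = 2 ^ dyadic_val y * v"
    and u: "residue u 1 = 1" "residue v 1 = 1" by (meson dyadic_val_decomp)
  have "x * y = 2 ^ (dyadic_val x + dyadic_val y) * (u * v)"
    by (subst x, subst y) (simp add: power_add mult_ac)
  moreover have "u * v \<noteq> 0" using odd_dyadic_mult[OF u] by (auto simp: zero_dyadic.rep_eq)
  ultimately show "x * y \<noteq> 0" using two_power_cancel_dyadic by metis
qed

lemma dyadic_val_mult:
  assumes "x \<noteq> 0" "y \<noteq> 0"
  shows "dyadic_val (x * y) = dyadic_val x + dyadic_val y"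
proof -
  let ?n = "dyadic_val x + dyadic_val y"
  obtain u v where x: "x = 2 ^ dyadic_val x * u" and y: "y = 2 ^ dyadic_val y * v"
    and u: "residue u 1 = 1" "residue v 1 = 1" using assms by (meson dyadic_val_decomp)
  have xy: "x * y = 2 ^ ?n * (u * v)"
    by (subst x, subst y) (simp add: power_add mult_ac)
  have two: "(2 :: dyadic) ^ ?n \<noteq> 0"
    using two_power_cancel_dyadic[of ?n 1] by (metis mult_1_right zero_neq_one)
  have "\<not> 2 ^ Suc ?n dvd x * y"
  proof
    assume "2 ^ Suc ?n dvd x * y"
    then have "2 ^ ?n * 2 dvd 2 ^ ?n * (u * v)" by (simp add: xy mult.commute)
    then have "2 ^ 1 dvd u * v" using two by (simp only: dvd_mult_cancel_left) simp
    then show False using odd_dyadic_mult[OF u] residue_eq_0_iff[of "u * v" 1] by simp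
  qed
  moreover have "2 ^ ?n dvd x * y" by (simp add: xy)
  moreover have "x * y \<noteq> 0" using assms by simp
  ultimately show ?thesis
    by (meson dyadic_val_dvd dyadic_val_greatest dvd_trans le_antisym le_imp_power_dvd
        not_less_eq_eq)
qed

definition dyadic_abs :: "dyadic \<Rightarrow> real"
  where "dyadic_abs x = (if x = 0 then 0 else (1 / 2) ^ dyadic_val x)"

lemma dyadic_abs_mult: "dyadic_abs (x * y) = dyadic_abs x * dyadic_abs y"
  by (simp add: dyadic_abs_def dyadic_val_mult power_add)

lemma dyadic_abs_eq_0_iff [simp]: "dyadic_abs x = 0 \<longleftrightarrow> x = 0"
  by (simp add: dyadic_abs_def)

type_synonym dyadic_num = "dyadic fract"

definition of_dyadic :: "dyadic \<Rightarrow> dyadic_num"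
  where "of_dyadic a = Fraction_Field.Fract a 1"

lift_definition dyadic_num_abs :: "dyadic_num \<Rightarrow> real"
  is "\<lambda>q. dyadic_abs (fst q) / dyadic_abs (snd q)"
proof -
  fix q r :: "dyadic \<times> dyadic"
  assume "fractrel q r"
  then show "dyadic_abs (fst q) / dyadic_abs (snd q) = dyadic_abs (fst r) / dyadic_abs (snd r)"
    by (simp add: frac_eq_eq dyadic_abs_mult[symmetric])
qed

lemma dyadic_num_abs_of_dyadic: "dyadic_num_abs (of_dyadic a) = dyadic_abs a"
proof -
  have "dyadic_val 1 = 0"
    using dyadic_val_mult[of 1 1] by simp
  then have "dyadic_abs 1 = 1" by (simp add: dyadic_abs_def)
  then show ?thesis unfolding of_dyadic_def by transfer simp
qed


section \<open>Polynomials\<close>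

text \<open>
  All polynomial rings $R[\xi_1,\dots,\xi_n]$ are realised inside the ring
  $R[\xi_1,\xi_2,\dots]$, with the variable $\xi_{i+1}$ given the index \<open>i\<close>.
  As this ring is the union of the subrings \<open>mpolys n\<close>, two functions on it are equal precisely
  if they agree on $R[\xi_1,\dots,\xi_n]$ for every \<open>n\<close>.
\<close>

type_synonym monomial = "nat \<Rightarrow>\<^sub>0 nat"
type_synonym 'a mpoly = "monomial \<Rightarrow>\<^sub>0 'a"

definition mpolys :: "nat \<Rightarrow> 'a::zero mpoly set"
  where "mpolys n = {f. \<forall>J \<in> Poly_Mapping.keys f. Poly_Mapping.keys J \<subseteq> {..<n}}"

definition mvar :: "nat \<Rightarrow> 'a::comm_ring_1 mpoly"
  where "mvar i = Poly_Mapping.single (Poly_Mapping.single i 1) 1"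

definition mconst :: "'a::comm_ring_1 \<Rightarrow> 'a mpoly"
  where "mconst c = Poly_Mapping.single 0 c"

definition mdeg :: "monomial \<Rightarrow> nat"
  where "mdeg J = (\<Sum>i \<in> Poly_Mapping.keys J. Poly_Mapping.lookup J i)"

definition hom_part :: "nat \<Rightarrow> 'a::comm_ring_1 mpoly \<Rightarrow> 'a mpoly"
  where "hom_part d f =
    (\<Sum>J \<in> {J \<in> Poly_Mapping.keys f. mdeg J = d}.
      Poly_Mapping.single J (Poly_Mapping.lookup f J))"


section \<open>The dyadic Steenrod algebra\<close>

definition Jq_total :: "dyadic mpoly \<Rightarrow> dyadic mpoly"
  where "Jq_total f =
    (\<Sum>J \<in> Poly_Mapping.keys f. mconst (Poly_Mapping.lookup f J) *
      (\<Prod>i \<in> Poly_Mapping.keys J. (mvar i + mvar i ^ 2) ^ Poly_Mapping.lookup J i))"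

definition Jq :: "nat \<Rightarrow> dyadic mpoly \<Rightarrow> dyadic mpoly"
  where "Jq k f =
    (\<Sum>d \<in> mdeg ` Poly_Mapping.keys f. hom_part (d + k) (Jq_total (hom_part d f)))"

inductive_set dyadic_Steenrod :: "(dyadic mpoly \<Rightarrow> dyadic mpoly) set"
  where
    gen: "Jq k \<in> dyadic_Steenrod"
  | unit: "(\<lambda>f. f) \<in> dyadic_Steenrod"
  | add: "\<theta> \<in> dyadic_Steenrod \<Longrightarrow> \<eta> \<in> dyadic_Steenrod \<Longrightarrow> (\<lambda>f. \<theta> f + \<eta> f) \<in> dyadic_Steenrod"
  | scale: "\<theta> \<in> dyadic_Steenrod \<Longrightarrow> (\<lambda>f. mconst c * \<theta> f) \<in> dyadic_Steenrod"
  | comp: "\<theta> \<in> dyadic_Steenrod \<Longrightarrow> \<eta> \<in> dyadic_Steenrod \<Longrightarrow> \<theta> \<circ> \<eta> \<in> dyadic_Steenrod"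

definition mpoly_of_dyadic :: "dyadic mpoly \<Rightarrow> dyadic_num mpoly"
  where "mpoly_of_dyadic f = Poly_Mapping.map of_dyadic f"

text \<open>The extension of a linear operator to the polynomials over the dyadic numbers.\<close>

definition extend_op :: "(dyadic mpoly \<Rightarrow> dyadic mpoly) \<Rightarrow> dyadic_num mpoly \<Rightarrow> dyadic_num mpoly"
  where "extend_op \<theta> f =
    (\<Sum>J \<in> Poly_Mapping.keys f.
      mconst (Poly_Mapping.lookup f J) * mpoly_of_dyadic (\<theta> (Poly_Mapping.single J 1)))"

definition mpoly_norm :: "dyadic_num mpoly \<Rightarrow> real"
  where "mpoly_norm f =
    Max (insert 0 ((\<lambda>J. dyadic_num_abs (Poly_Mapping.lookup f J)) ` Poly_Mapping.keys f))"

text \<open>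
  Elements of the dyadic Steenrod algebra have integral coefficients, so \<open>c = 1\<close> is always a
  bound for them and the real infimum is over a nonempty set.
\<close>

definition L_norm :: "(dyadic mpoly \<Rightarrow> dyadic mpoly) \<Rightarrow> real"
  where "L_norm \<theta> =
    Inf {c. 0 \<le> c \<and> (\<forall>n. \<forall>f \<in> mpolys n. mpoly_norm (extend_op \<theta> f) \<le> c * mpoly_norm f)}"

definition B_L :: "real \<Rightarrow> (dyadic mpoly \<Rightarrow> dyadic mpoly) set"
  where "B_L r = {\<theta> \<in> dyadic_Steenrod. L_norm \<theta> < r}"

definition act_span ::
    "(dyadic mpoly \<Rightarrow> dyadic mpoly) set \<Rightarrow> dyadic mpoly set \<Rightarrow> dyadic mpoly set"
  where "act_span B M =
    {(\<Sum>i<m. \<theta> i (f i)) | (m :: nat) \<theta> f. (\<forall>i<m. \<theta> i \<in> B \<and> f i \<in> M)}"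


section \<open>The completion and the Tate algebra\<close>

definition add_group :: "'a::ab_group_add set \<Rightarrow> 'a monoid"
  where "add_group A = \<lparr>carrier = A, mult = (+), one = 0\<rparr>"

text \<open>The limit of a tower of groups \<open>G k\<close> with maps \<open>p k\<close> from \<open>G (Suc k)\<close> to \<open>G k\<close>.\<close>

definition inverse_limit :: "(nat \<Rightarrow> 'a monoid) \<Rightarrow> (nat \<Rightarrow> 'a \<Rightarrow> 'a) \<Rightarrow> (nat \<Rightarrow> 'a) monoid"
  where "inverse_limit G p =
    \<lparr>carrier = {x. \<forall>k. x k \<in> carrier (G k) \<and> p k (x (Suc k)) = x k},
     mult = (\<lambda>x y k. x k \<otimes>\<^bsub>G k\<^esub> y k),
     one = (\<lambda>k. \<one>\<^bsub>G k\<^esub>)\<rparr>"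

abbreviation poly1 :: "dyadic mpoly monoid"
  where "poly1 \<equiv> add_group (mpolys 1)"

definition L_sub :: "nat \<Rightarrow> dyadic mpoly set"
  where "L_sub k = act_span (B_L (1 / 2 ^ k)) (mpolys 1)"

text \<open>
  Since \<open>L_sub (Suc k)\<close> is contained in \<open>L_sub k\<close>, adding \<open>L_sub k\<close> to a coset of \<open>L_sub (Suc k)\<close>
  gives the coset of \<open>L_sub k\<close> containing it, i.e. its image under the natural projection.
\<close>

definition L_completion :: "(nat \<Rightarrow> dyadic mpoly set) monoid"
  where "L_completion =
    inverse_limit (\<lambda>k. poly1 Mod L_sub k) (\<lambda>k C. L_sub k <#>\<^bsub>poly1\<^esub> C)"

definition to_L_completion :: "dyadic mpoly \<Rightarrow> nat \<Rightarrow> dyadic mpoly set"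
  where "to_L_completion f = (\<lambda>k. L_sub k #>\<^bsub>poly1\<^esub> f)"

definition Tate_1 :: "dyadic fps set"
  where "Tate_1 = {a. (\<lambda>m. dyadic_abs (fps_nth a m)) \<longlonglongrightarrow> 0}"

definition to_Tate_1 :: "dyadic mpoly \<Rightarrow> dyadic fps"
  where "to_Tate_1 f = Abs_fps (\<lambda>m. Poly_Mapping.lookup f (Poly_Mapping.single 0 m))"

end

theory Submission
  imports Defs
begin

text \<open>
  An operator with \<open>L_norm \<theta> < 1 / 2 ^ k\<close> sends every monomial, and hence every polynomial, to a
  multiple of $2^{k+1}$, because the dyadic absolute value is discrete. Conversely multiplication
  by $2^{k+1}$ is itself such an operator. So \<open>L_sub k\<close> is $2^{k+1}\mathbb{Z}_2[\xi]$, and the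
  completion is the $2$-adic completion of $\mathbb{Z}_2[\xi]$: a compatible family of cosets is
  a power series that is a polynomial modulo every power of $2$, i.e. an element of the Tate
  algebra.
\<close>

section \<open>Dyadic absolute values\<close>

text \<open>Translates between absolute values and divisibility. The case \<open>x = 0\<close> is
  separate because \<open>dyadic_val 0\<close> is an unspecified \<open>GREATEST\<close>.\<close>

lemma dyadic_abs_le_iff: "dyadic_abs x \<le> (1 / 2) ^ n \<longleftrightarrow> 2 ^ n dvd x"
proof (cases "x = 0")
  case False
  have "dyadic_abs x \<le> (1 / 2) ^ n \<longleftrightarrow> n \<le> dyadic_val x"
    using False by (simp add: dyadic_abs_def power_decreasing_iff)
  also have "\<dots> \<longleftrightarrow> 2 ^ n dvd x"
    using dyadic_val_dvd[OF False] dyadic_val_greatest[OF False]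
    by (meson dvd_trans le_imp_power_dvd)
  finally show ?thesis .
qed (simp add: dyadic_abs_def)

lemma dyadic_abs_nonneg [simp]: "0 \<le> dyadic_abs x"
  by (simp add: dyadic_abs_def)

lemma dyadic_abs_le_1: "dyadic_abs x \<le> 1"
  using dyadic_abs_le_iff[of x 0] by simp

text \<open>The nonzero values are powers of 1/2, so a strict inequality gains one more factor 2.
  This is the source of every \<open>Suc k\<close> below.\<close>

lemma dyadic_abs_less_imp_dvd: "dyadic_abs x < (1 / 2) ^ n \<Longrightarrow> 2 ^ Suc n dvd x"
proof (cases "x = 0")
  case False
  assume "dyadic_abs x < (1 / 2) ^ n"
  then have "n < dyadic_val x"
    using False by (simp add: dyadic_abs_def power_strict_decreasing_iff)
  then show ?thesis
    using dyadic_val_dvd[OF False] by (meson Suc_leI dvd_trans le_imp_power_dvd)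
qed simp

text \<open>Ultrametric inequality: by symmetry let \<open>x\<close> have the larger absolute value;
  then \<open>2 ^ dyadic_val x\<close> divides both summands.\<close>

lemma dyadic_abs_add: "dyadic_abs (x + y) \<le> max (dyadic_abs x) (dyadic_abs y)"
proof -
  have *: "dyadic_abs (x + y) \<le> dyadic_abs x" if "dyadic_abs y \<le> dyadic_abs x" for x y
  proof (cases "x = 0")
    case True
    then have "y = 0" using that dyadic_abs_nonneg[of y]
      by (simp add: dyadic_abs_def split: if_splits)
    then show ?thesis using True by simp
  next
    case False
    then have x: "dyadic_abs x = (1 / 2) ^ dyadic_val x" by (simp add: dyadic_abs_def)
    then have "2 ^ dyadic_val x dvd x + y"
      using that dyadic_val_dvd[OF False] by (intro dvd_add) (simp_all add: dyadic_abs_le_iff)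
    then show ?thesis by (simp add: x dyadic_abs_le_iff)
  qed
  show ?thesis
    using *[of x y] *[of y x] by (auto simp: add.commute max_def)
qed

section \<open>The absolute value on the fraction field\<close>

lemma dyadic_num_abs_Fract:
  "b \<noteq> 0 \<Longrightarrow> dyadic_num_abs (Fraction_Field.Fract a b) = dyadic_abs a / dyadic_abs b"
  by transfer simp

lemma dyadic_num_abs_mult: "dyadic_num_abs (x * y) = dyadic_num_abs x * dyadic_num_abs y"
  by (cases x; cases y) (simp add: dyadic_num_abs_Fract dyadic_abs_mult)

lemma dyadic_num_abs_nonneg [simp]: "0 \<le> dyadic_num_abs x"
  by (cases x) (simp add: dyadic_num_abs_Fract)

lemma dyadic_num_abs_0 [simp]: "dyadic_num_abs 0 = 0"
  by (simp add: Zero_fract_def dyadic_num_abs_Fract)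

lemma dyadic_num_abs_add:
  "dyadic_num_abs (x + y) \<le> max (dyadic_num_abs x) (dyadic_num_abs y)"
proof -
  obtain a b where x: "x = Fraction_Field.Fract a b" "b \<noteq> 0" by (cases x)
  obtain c d where y: "y = Fraction_Field.Fract c d" "d \<noteq> 0" by (cases y)
  have pos: "0 < dyadic_abs b" "0 < dyadic_abs d"
    using x y dyadic_abs_nonneg by (simp_all add: less_le)
  have "dyadic_num_abs (x + y) = dyadic_abs (a * d + c * b) / (dyadic_abs b * dyadic_abs d)"
    using x y by (simp add: dyadic_num_abs_Fract dyadic_abs_mult)
  also have "\<dots> \<le> max (dyadic_abs (a * d)) (dyadic_abs (c * b)) / (dyadic_abs b * dyadic_abs d)"
    using pos by (intro divide_right_mono dyadic_abs_add) simp
  also have "\<dots> = max (dyadic_num_abs x) (dyadic_num_abs y)"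
    using x y pos by (auto simp: dyadic_num_abs_Fract dyadic_abs_mult max_def field_simps)
  finally show ?thesis .
qed

lemma dyadic_num_abs_sum_le:
  assumes "0 \<le> c" "\<And>i. i \<in> A \<Longrightarrow> dyadic_num_abs (g i) \<le> c"
  shows "dyadic_num_abs (sum g A) \<le> c"
  using assms(2)
proof (induction A rule: infinite_finite_induct)
  case (insert i A)
  then show ?case using dyadic_num_abs_add[of "g i" "sum g A"] by force
qed (use assms(1) in simp_all)

lemma of_dyadic_0 [simp]: "of_dyadic 0 = 0"
  by (simp add: of_dyadic_def Zero_fract_def)

section \<open>Separation and completeness of the dyadic integers\<close>

lemma dyadic_eqI: "(\<And>n. 2 ^ Suc n dvd x - y) \<Longrightarrow> x = (y :: dyadic)"
  using dyadic_val_exists[of "x - y"] by (metis Suc_n_not_le_n right_minus_eq)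

text \<open>Residues are stored in reduced form, so congruent ones are equal.\<close>

lemma residue_eq_iff: "residue x n = residue y n \<longleftrightarrow> 2 ^ n dvd x - y"
proof -
  have r: "0 \<le> residue z n \<and> residue z n < 2 ^ n" for z using residue[of z] by auto
  have "2 ^ n dvd x - y \<longleftrightarrow> (residue x n - residue y n) mod 2 ^ n = 0"
    by (simp add: residue_eq_0_iff[symmetric] minus_dyadic.rep_eq)
  also have "\<dots> \<longleftrightarrow> residue x n mod 2 ^ n = residue y n mod 2 ^ n"
    by (simp add: mod_eq_dvd_iff dvd_eq_mod_eq_0)
  finally show ?thesis using r[of x] r[of y] by simp
qed

text \<open>The limit is built from the diagonal of residues. It will supply the coefficients of the
  power series attached to a point of the completion.\<close>

lemma dyadic_complete:
  fixes z :: "nat \<Rightarrow> dyadic"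
  assumes "\<And>k. 2 ^ Suc k dvd z (Suc k) - z k"
  obtains a where "\<And>k. 2 ^ Suc k dvd a - z k"
proof
  let ?y = "\<lambda>n. residue (z n) n"
  \<comment> \<open>At level \<open>Suc k\<close> the diagonal entry may be read off
    \<open>z k\<close> as well. This makes the diagonal compatible and yields congruence with
    \<open>z k\<close> modulo \<open>2 ^ Suc k\<close> instead of only \<open>2 ^ k\<close>.\<close>
  have step: "residue (z (Suc k)) (Suc k) = residue (z k) (Suc k)" for k
    using assms by (simp only: residue_eq_iff)
  have "0 \<le> ?y n \<and> ?y n < 2 ^ n \<and> ?y (Suc n) mod 2 ^ n = ?y n" for n
    using residue[of "z n"] by (simp add: step residue_mod)
  then have "residue (Abs_dyadic ?y) = ?y" by (simp add: Abs_dyadic_inverse)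
  then show "2 ^ Suc k dvd Abs_dyadic ?y - z k" for k
    by (simp only: residue_eq_iff[symmetric] step)
qed

section \<open>The polynomial ring\<close>

lemma lookup_mconst_mult [simp]:
  "Poly_Mapping.lookup (mconst c * f) J = c * Poly_Mapping.lookup f J"
  unfolding mconst_def mult_map_scale_conv_mult[symmetric]
  by (simp add: Poly_Mapping.map.rep_eq when_def)

lemma lookup_hom_part:
  "Poly_Mapping.lookup (hom_part d f) J = (if mdeg J = d then Poly_Mapping.lookup f J else 0)"
  by (auto simp: hom_part_def lookup_sum lookup_single when_def in_keys_iff
      sum.delta[where a = J])

lemma hom_part_add: "hom_part d (f + g) = hom_part d f + hom_part d g"
  by (rule poly_mapping_eqI) (simp add: lookup_hom_part lookup_add)

lemma hom_part_mconst: "hom_part d (mconst c * f) = mconst c * hom_part d f"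
  by (rule poly_mapping_eqI) (simp add: lookup_hom_part)

lemma hom_part_0 [simp]: "hom_part d 0 = 0"
  by (rule poly_mapping_eqI) (simp add: lookup_hom_part)

lemma hom_part_eq_0: "d \<notin> mdeg ` Poly_Mapping.keys f \<Longrightarrow> hom_part d f = 0"
  by (rule poly_mapping_eqI) (auto simp: lookup_hom_part in_keys_iff)

lemma mconst_0 [simp]: "mconst 0 = 0" and mconst_1 [simp]: "mconst 1 = 1"
  by (simp_all add: mconst_def)

lemma mconst_add: "mconst (a + b) = mconst a + mconst b"
  by (simp add: mconst_def single_add)

lemma mconst_mult: "mconst (a * b) = mconst a * mconst b"
  by (simp add: mconst_def mult_single)

lemma mconst_mult_single: "mconst c * Poly_Mapping.single J b = Poly_Mapping.single J (c * b)"
  by (simp add: mconst_def mult_single)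

lemma lookup_mpoly_of_dyadic [simp]:
  "Poly_Mapping.lookup (mpoly_of_dyadic f) J = of_dyadic (Poly_Mapping.lookup f J)"
  by (simp add: mpoly_of_dyadic_def Poly_Mapping.map.rep_eq when_def)

section \<open>The subrings of polynomials in finitely many variables\<close>

lemma mpolys_0 [simp]: "0 \<in> mpolys n"
  by (simp add: mpolys_def)

lemma mpolys_add: "f \<in> mpolys n \<Longrightarrow> g \<in> mpolys n \<Longrightarrow> f + g \<in> mpolys n"
  using Poly_Mapping.keys_add[of f g] by (fastforce simp: mpolys_def)

lemma mpolys_uminus: "f \<in> mpolys n \<Longrightarrow> - (f :: 'a::ab_group_add mpoly) \<in> mpolys n"
  by (simp add: mpolys_def)

lemma mpolys_diff:
  "f \<in> mpolys n \<Longrightarrow> g \<in> mpolys n \<Longrightarrow> f - (g :: 'a::ab_group_add mpoly) \<in> mpolys n"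
  using mpolys_add[of f n "- g"] mpolys_uminus[of g n] by simp

lemma mpolys_mult: "f \<in> mpolys n \<Longrightarrow> g \<in> mpolys n \<Longrightarrow> f * g \<in> mpolys n"
  unfolding mpolys_def
proof safe
  fix J i
  assume fg: "\<forall>J\<in>Poly_Mapping.keys f. Poly_Mapping.keys J \<subseteq> {..<n}"
    "\<forall>J\<in>Poly_Mapping.keys g. Poly_Mapping.keys J \<subseteq> {..<n}"
    and "J \<in> Poly_Mapping.keys (f * g)" and i: "i \<in> Poly_Mapping.keys J"
  then obtain a b where "a \<in> Poly_Mapping.keys f" "b \<in> Poly_Mapping.keys g" "J = a + b"
    using keys_mult[of f g] by blast
  then show "i < n" using fg i Poly_Mapping.keys_add[of a b] by blast
qed

lemma mpolys_sum: "(\<And>i. i \<in> A \<Longrightarrow> g i \<in> mpolys n) \<Longrightarrow> sum g A \<in> mpolys n"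
  by (induction A rule: infinite_finite_induct) (auto intro: mpolys_add)

lemma mpolys_mconst: "mconst c \<in> mpolys n"
  by (simp add: mpolys_def mconst_def)

lemma mpolys_1: "(1 :: 'a::comm_ring_1 mpoly) \<in> mpolys n"
  using mpolys_mconst[of 1 n] by simp

lemma mpolys_power: "f \<in> mpolys n \<Longrightarrow> (f :: 'a::comm_ring_1 mpoly) ^ m \<in> mpolys n"
  by (induction m) (auto intro: mpolys_mult mpolys_1)

lemma mpolys_prod:
  "(\<And>i. i \<in> A \<Longrightarrow> g i \<in> mpolys n) \<Longrightarrow> prod g A \<in> (mpolys n :: 'a::comm_ring_1 mpoly set)"
  by (induction A rule: infinite_finite_induct) (auto intro: mpolys_mult mpolys_1)

lemma mpolys_mvar: "i < n \<Longrightarrow> mvar i \<in> mpolys n"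
  by (simp add: mpolys_def mvar_def)

lemma mpolys_hom_part: "f \<in> mpolys n \<Longrightarrow> hom_part d f \<in> mpolys n"
  by (auto simp: mpolys_def in_keys_iff lookup_hom_part split: if_splits)

text \<open>In one variable every monomial is a power of the variable with index 0, so conditions on
  the coefficients at \<open>single 0 m\<close> control the whole polynomial.\<close>

lemma mpolys_1_lookup_eq_0:
  assumes "f \<in> mpolys 1" "\<And>m. J \<noteq> Poly_Mapping.single 0 m"
  shows "Poly_Mapping.lookup f J = 0"
proof (rule ccontr)
  assume "Poly_Mapping.lookup f J \<noteq> 0"
  then have "Poly_Mapping.keys J \<subseteq> {..<1}"
    using assms(1) by (auto simp: mpolys_def in_keys_iff)
  then have "Poly_Mapping.lookup J i = 0" if "i \<noteq> 0" for i
    using that by (auto simp: in_keys_iff subset_iff)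
  then have "J = Poly_Mapping.single 0 (Poly_Mapping.lookup J 0)"
    by (intro poly_mapping_eqI) (simp add: lookup_single when_def)
  then show False using assms(2) by blast
qed

section \<open>Operators in the dyadic Steenrod algebra\<close>

text \<open>Linearity over the dyadic integers only: scalars act as constant polynomials.\<close>

definition mlinear :: "(dyadic mpoly \<Rightarrow> dyadic mpoly) \<Rightarrow> bool"
  where "mlinear \<theta> \<longleftrightarrow> (\<forall>f g. \<theta> (f + g) = \<theta> f + \<theta> g) \<and> (\<forall>c f. \<theta> (mconst c * f) = mconst c * \<theta> f)"

lemma mlinearD:
  assumes "mlinear \<theta>"
  shows "\<theta> (f + g) = \<theta> f + \<theta> g" "\<theta> (mconst c * f) = mconst c * \<theta> f"
  using assms by (auto simp: mlinear_def)

text \<open>The right-hand side has the shape of \<open>extend_op\<close>; it carries bounds on the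
  images of monomials over to all polynomials.\<close>

lemma mlinear_expand:
  assumes "mlinear \<theta>"
  shows "\<theta> f = (\<Sum>J\<in>Poly_Mapping.keys f.
    mconst (Poly_Mapping.lookup f J) * \<theta> (Poly_Mapping.single J 1))"
proof -
  have z: "\<theta> 0 = 0" using mlinearD(2)[OF assms, of 0 0] by simp
  have s: "\<theta> (sum g A) = (\<Sum>i\<in>A. \<theta> (g i))" if "finite A" for g :: "monomial \<Rightarrow> _" and A
    using that by (induction A) (auto simp: z mlinearD(1)[OF assms])
  have "f = (\<Sum>J\<in>Poly_Mapping.keys f.
      mconst (Poly_Mapping.lookup f J) * Poly_Mapping.single J 1)"
    by (rule poly_mapping_eqI) (simp add: mconst_mult_single lookup_sum lookup_single when_def
      in_keys_iff)
  then have "\<theta> f = \<theta> (\<Sum>J\<in>Poly_Mapping.keys f.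
      mconst (Poly_Mapping.lookup f J) * Poly_Mapping.single J 1)"
    by simp
  then show ?thesis by (simp add: s mlinearD(2)[OF assms])
qed

text \<open>The range of summation depends on \<open>f\<close>, but enlarging it to a finite
  superset of the keys adds only zero terms. Additivity is checked over a common range.\<close>

lemma mlinear_keys_sum:
  "mlinear (\<lambda>f. \<Sum>J\<in>Poly_Mapping.keys f. mconst (Poly_Mapping.lookup f J) * t J)"
proof -
  let ?S = "\<lambda>f. \<Sum>J\<in>Poly_Mapping.keys f. mconst (Poly_Mapping.lookup f J) * t J"
  have ext: "?S f = (\<Sum>J\<in>A. mconst (Poly_Mapping.lookup f J) * t J)"
    if "finite A" "Poly_Mapping.keys f \<subseteq> A" for f A
    using that by (intro sum.mono_neutral_left) (auto simp: in_keys_iff)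
  show ?thesis unfolding mlinear_def
  proof (intro conjI allI)
    fix f g :: "dyadic mpoly"
    let ?A = "Poly_Mapping.keys f \<union> Poly_Mapping.keys g"
    show "?S (f + g) = ?S f + ?S g"
      using ext[of ?A f] ext[of ?A g] ext[of ?A "f + g"]
      by (simp add: Poly_Mapping.keys_add lookup_add mconst_add distrib_right sum.distrib)
  next
    fix c and f :: "dyadic mpoly"
    have "Poly_Mapping.keys (mconst c * f) \<subseteq> Poly_Mapping.keys f"
      by (auto simp: in_keys_iff)
    then have "?S (mconst c * f) = (\<Sum>J\<in>Poly_Mapping.keys f.
        mconst (Poly_Mapping.lookup (mconst c * f) J) * t J)"
      by (intro ext) simp
    then show "?S (mconst c * f) = mconst c * ?S f"
      by (simp add: mconst_mult sum_distrib_left mult.assoc)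
  qed
qed

lemma mlinear_Jq_total: "mlinear Jq_total"
  using mlinear_keys_sum unfolding Jq_total_def[abs_def] .

lemma Jq_total_0 [simp]: "Jq_total 0 = 0"
  by (simp add: Jq_total_def)

text \<open>The same enlargement of the range, now for the set of degrees: a degree that does not
  occur in \<open>f\<close> contributes 0.\<close>

lemma mlinear_Jq: "mlinear (Jq k)"
proof -
  let ?T = "\<lambda>f d. hom_part (d + k) (Jq_total (hom_part d f))"
  have ext: "Jq k f = sum (?T f) D" if "finite D" "mdeg ` Poly_Mapping.keys f \<subseteq> D" for f D
    unfolding Jq_def using that
    by (intro sum.mono_neutral_left) (auto simp: hom_part_eq_0)
  show ?thesis unfolding mlinear_def
  proof (intro conjI allI)
    fix f g :: "dyadic mpoly"
    let ?D = "mdeg ` (Poly_Mapping.keys f \<union> Poly_Mapping.keys g)"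
    have "mdeg ` Poly_Mapping.keys (f + g) \<subseteq> ?D"
      by (intro image_mono Poly_Mapping.keys_add)
    then have "Jq k (f + g) = sum (?T (f + g)) ?D" by (rule ext[rotated]) simp
    moreover have "Jq k f = sum (?T f) ?D" "Jq k g = sum (?T g) ?D"
      by (rule ext; auto)+
    ultimately show "Jq k (f + g) = Jq k f + Jq k g"
      by (simp only: hom_part_add mlinearD(1)[OF mlinear_Jq_total] sum.distrib)
  next
    fix c and f :: "dyadic mpoly"
    have "Jq k (mconst c * f) = sum (?T (mconst c * f)) (mdeg ` Poly_Mapping.keys f)"
      by (intro ext) (auto simp: in_keys_iff)
    then show "Jq k (mconst c * f) = mconst c * Jq k f"
      by (simp only: Jq_def hom_part_mconst mlinearD(2)[OF mlinear_Jq_total] sum_distrib_left)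
  qed
qed

lemma dyadic_Steenrod_mlinear: "\<theta> \<in> dyadic_Steenrod \<Longrightarrow> mlinear \<theta>"
proof (induction rule: dyadic_Steenrod.induct)
  case (gen k)
  show ?case by (rule mlinear_Jq)
qed (auto simp: mlinear_def algebra_simps)

section \<open>Stability of the polynomial subrings under the operators\<close>

lemma mpolys_Jq_total: "f \<in> mpolys n \<Longrightarrow> Jq_total f \<in> mpolys n"
  unfolding Jq_total_def
  by (intro mpolys_sum mpolys_mult mpolys_prod mpolys_power mpolys_add mpolys_mconst mpolys_mvar)
    (auto simp: mpolys_def)

text \<open>Ensures that \<open>L_sub k\<close> stays in one variable: \<open>Jq_total\<close>
  replaces each variable by a polynomial in that variable, and \<open>hom_part\<close> only drops
  terms.\<close>

lemma dyadic_Steenrod_mpolys: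
  "\<theta> \<in> dyadic_Steenrod \<Longrightarrow> f \<in> mpolys n \<Longrightarrow> \<theta> f \<in> mpolys n"
proof (induction arbitrary: f rule: dyadic_Steenrod.induct)
  case (gen k)
  then show ?case
    unfolding Jq_def by (intro mpolys_sum mpolys_hom_part mpolys_Jq_total)
qed (auto intro: mpolys_add mpolys_mult mpolys_mconst)

section \<open>The norm of polynomials and the operator norm\<close>

lemma mpoly_norm_ge: "dyadic_num_abs (Poly_Mapping.lookup f J) \<le> mpoly_norm f"
  unfolding mpoly_norm_def
  by (cases "J \<in> Poly_Mapping.keys f") (auto intro!: Max_ge simp: in_keys_iff)

lemma mpoly_norm_leI:
  "0 \<le> c \<Longrightarrow> (\<And>J. dyadic_num_abs (Poly_Mapping.lookup f J) \<le> c) \<Longrightarrow> mpoly_norm f \<le> c"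
  by (auto simp: mpoly_norm_def)

lemma mpoly_norm_nonneg [simp]: "0 \<le> mpoly_norm f"
  by (simp add: mpoly_norm_def)

text \<open>Each coefficient of the image is a sum of products bounded by
  \<open>mpoly_norm f * c\<close>, and the ultrametric inequality gives the sum the same
  bound.\<close>

lemma mpoly_norm_extend_op_le:
  assumes "0 \<le> c" "\<And>J K. dyadic_abs (Poly_Mapping.lookup (\<theta> (Poly_Mapping.single J 1)) K) \<le> c"
  shows "mpoly_norm (extend_op \<theta> f) \<le> c * mpoly_norm f"
proof (rule mpoly_norm_leI)
  fix K
  have "dyadic_num_abs (Poly_Mapping.lookup f J) *
      dyadic_abs (Poly_Mapping.lookup (\<theta> (Poly_Mapping.single J 1)) K) \<le> mpoly_norm f * c" for J
    using assms by (intro mult_mono mpoly_norm_ge) auto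
  then show "dyadic_num_abs (Poly_Mapping.lookup (extend_op \<theta> f) K) \<le> c * mpoly_norm f"
    using assms(1) unfolding extend_op_def lookup_sum
    by (intro dyadic_num_abs_sum_le)
      (simp_all add: dyadic_num_abs_mult dyadic_num_abs_of_dyadic mult.commute)
qed (simp add: assms)

lemma extend_op_single:
  "extend_op \<theta> (Poly_Mapping.single J 1) = mpoly_of_dyadic (\<theta> (Poly_Mapping.single J 1))"
  by (simp add: extend_op_def)

lemma L_norm_le:
  assumes "0 \<le> c" "\<And>J K. dyadic_abs (Poly_Mapping.lookup (\<theta> (Poly_Mapping.single J 1)) K) \<le> c"
  shows "L_norm \<theta> \<le> c"
  unfolding L_norm_def
  using assms by (intro cInf_lower) (auto intro: bdd_belowI mpoly_norm_extend_op_le)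

text \<open>An admissible constant below \<open>r\<close> is tested on a single monomial, which has
  norm 1.\<close>

lemma L_norm_less_imp_lookup:
  assumes "L_norm \<theta> < r"
  shows "dyadic_abs (Poly_Mapping.lookup (\<theta> (Poly_Mapping.single J 1)) K) < r"
proof -
  let ?C = "{c. 0 \<le> c \<and> (\<forall>n. \<forall>f \<in> mpolys n. mpoly_norm (extend_op \<theta> f) \<le> c * mpoly_norm f)}"
  \<comment> \<open>The set must be nonempty before an element below \<open>r\<close> can be drawn
    from its infimum; integrality of the coefficients provides 1.\<close>
  have "1 \<in> ?C"
    using mpoly_norm_extend_op_le[of 1 \<theta>] dyadic_abs_le_1 by auto
  then obtain c where c: "c \<in> ?C" "c < r"
    using assms cInf_lessD[of ?C r] unfolding L_norm_def by blast
  let ?e = "Poly_Mapping.single J 1 :: dyadic_num mpoly"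
  have "dyadic_num_abs 1 = 1"
    using dyadic_num_abs_mult[of 1 1] by (auto simp: One_fract_def dyadic_num_abs_Fract)
  then have norm: "mpoly_norm ?e = 1" by (simp add: mpoly_norm_def)
  \<comment> \<open>The bounds in \<open>?C\<close> are stated for each \<open>mpolys n\<close>, so
    some \<open>n\<close> containing the monomial has to be named.\<close>
  obtain n where "Poly_Mapping.keys J \<subseteq> {..<n}"
    using finite_nat_set_iff_bounded[of "Poly_Mapping.keys J"] by auto
  then have "?e \<in> mpolys n" by (simp add: mpolys_def)
  then have "mpoly_norm (extend_op \<theta> ?e) \<le> c" using c norm by fastforce
  then have "dyadic_num_abs (Poly_Mapping.lookup (extend_op \<theta> ?e) K) \<le> c"
    using mpoly_norm_ge order_trans by blast
  then show ?thesis
    using c(2) by (simp add: extend_op_single dyadic_num_abs_of_dyadic)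
qed

section \<open>The subgroups \<open>L_sub k\<close> as multiples of powers of 2\<close>

lemma B_L_dvd:
  assumes "\<theta> \<in> B_L (1 / 2 ^ k)"
  shows "2 ^ Suc k dvd Poly_Mapping.lookup (\<theta> f) K"
proof -
  have \<theta>: "mlinear \<theta>" "L_norm \<theta> < (1 / 2) ^ k"
    using assms by (auto simp: B_L_def dyadic_Steenrod_mlinear power_one_over)
  show ?thesis
    unfolding mlinear_expand[OF \<theta>(1), of f] lookup_sum lookup_mconst_mult
    by (intro dvd_sum dvd_mult dyadic_abs_less_imp_dvd L_norm_less_imp_lookup \<theta>(2))
qed

lemma mult_two_power_in_B_L: "(\<lambda>f. mconst (2 ^ Suc k) * f) \<in> B_L (1 / 2 ^ k)"
proof -
  have "L_norm (\<lambda>f. mconst (2 ^ Suc k) * f) \<le> (1 / 2) ^ Suc k"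
    by (rule L_norm_le)
      (simp_all only: lookup_mconst_mult dyadic_abs_le_iff dvd_triv_left zero_le_power
        zero_le_divide_1_iff zero_le_numeral)
  also have "\<dots> < 1 / 2 ^ k" by (simp add: power_one_over field_simps)
  finally show ?thesis
    unfolding B_L_def using dyadic_Steenrod.scale[OF dyadic_Steenrod.unit] by blast
qed

text \<open>Forwards, every summand is divisible by \<open>B_L_dvd\<close>. Backwards,
  \<open>f\<close> divided by \<open>2 ^ Suc k\<close> is a polynomial, and multiplication by
  \<open>2 ^ Suc k\<close> lies in the ball, so one summand suffices.\<close>

lemma L_sub_iff:
  "f \<in> L_sub k \<longleftrightarrow>
    f \<in> mpolys 1 \<and> (\<forall>m. 2 ^ Suc k dvd Poly_Mapping.lookup f (Poly_Mapping.single 0 m))"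
proof
  assume "f \<in> L_sub k"
  then obtain n :: nat and \<theta> g where f: "f = (\<Sum>i<n. \<theta> i (g i))"
    and \<theta>: "\<forall>i<n. \<theta> i \<in> B_L (1 / 2 ^ k) \<and> g i \<in> mpolys 1"
    unfolding L_sub_def act_span_def mem_Collect_eq by blast
  have "\<theta> i (g i) \<in> mpolys 1" if "i < n" for i
    using \<theta> that by (intro dyadic_Steenrod_mpolys[of "\<theta> i"]) (auto simp: B_L_def)
  then have "f \<in> mpolys 1"
    unfolding f by (intro mpolys_sum) simp
  moreover have "2 ^ Suc k dvd Poly_Mapping.lookup f K" for K
    unfolding f lookup_sum using \<theta> by (intro dvd_sum B_L_dvd[of "\<theta> _"]) auto
  ultimately show
    "f \<in> mpolys 1 \<and> (\<forall>m. 2 ^ Suc k dvd Poly_Mapping.lookup f (Poly_Mapping.single 0 m))"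
    by blast
next
  assume f: "f \<in> mpolys 1 \<and> (\<forall>m. 2 ^ Suc k dvd Poly_Mapping.lookup f (Poly_Mapping.single 0 m))"
  then have dvd: "2 ^ Suc k dvd Poly_Mapping.lookup f J" for J
    using mpolys_1_lookup_eq_0[of f J] by (metis dvd_0_right)
  define q where "q J = (SOME y. Poly_Mapping.lookup f J = 2 ^ Suc k * y)" for J
  have q: "Poly_Mapping.lookup f J = 2 ^ Suc k * q J" for J
    using someI_ex[OF dvd[of J, unfolded dvd_def]] unfolding q_def .
  \<comment> \<open>Summing over the keys of \<open>f\<close> turns the coefficientwise quotients
    into a polynomial.\<close>
  define g where "g = (\<Sum>J\<in>Poly_Mapping.keys f. Poly_Mapping.single J (q J))"
  have g: "Poly_Mapping.lookup g J = (if J \<in> Poly_Mapping.keys f then q J else 0)" for J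
    by (simp add: g_def lookup_sum lookup_single when_def)
  have "g \<in> mpolys 1"
    unfolding g_def using f by (intro mpolys_sum) (auto simp: mpolys_def)
  moreover have "f = mconst (2 ^ Suc k) * g"
    by (rule poly_mapping_eqI) (simp add: g q[symmetric] in_keys_iff del: power_Suc)
  ultimately show "f \<in> L_sub k"
    unfolding L_sub_def act_span_def using mult_two_power_in_B_L[of k]
    by (intro CollectI exI[of _ "1 :: nat"] exI[of _ "\<lambda>_ f. mconst (2 ^ Suc k) * f"]
        exI[of _ "\<lambda>_. g"]) simp
qed

section \<open>The completion and the Tate algebra\<close>

text \<open>Discreteness turns a bound below \<open>(1 / 2) ^ k\<close> into divisibility by
  \<open>2 ^ Suc k\<close>; conversely the powers of 1/2 fall below every positive bound.\<close>

lemma Tate_1_iff: "a \<in> Tate_1 \<longleftrightarrow> (\<forall>k. \<forall>\<^sub>F m in sequentially. 2 ^ Suc k dvd fps_nth a m)"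
proof
  assume "a \<in> Tate_1"
  then have "\<forall>\<^sub>F m in sequentially. dyadic_abs (fps_nth a m) < (1 / 2) ^ k" for k
    unfolding Tate_1_def by (auto dest: order_tendstoD(2)[where a = "(1 / 2) ^ k"])
  then show "\<forall>k. \<forall>\<^sub>F m in sequentially. 2 ^ Suc k dvd fps_nth a m"
    using dyadic_abs_less_imp_dvd by (blast intro: eventually_mono)
next
  assume ev: "\<forall>k. \<forall>\<^sub>F m in sequentially. 2 ^ Suc k dvd fps_nth a m"
  have "\<forall>\<^sub>F m in sequentially. dyadic_abs (fps_nth a m) < e" if e: "0 < e" for e
  proof -
    obtain k where k: "(1 / 2) ^ k < e" using real_arch_pow_inv[OF e, of "1 / 2"] by auto
    have "(1 / 2 :: real) ^ Suc k < e"
      using k power_decreasing[of k "Suc k" "1 / 2 :: real"] by linarith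
    with ev show ?thesis
      by (auto elim!: eventually_mono[OF spec[of _ k]] simp: dyadic_abs_le_iff[symmetric]
          simp del: power_Suc)
  qed
  then show "a \<in> Tate_1"
    unfolding Tate_1_def
    by (auto intro!: order_tendstoI intro: always_eventually less_le_trans[OF _ dyadic_abs_nonneg])
qed

lemma Tate_1_add:
  assumes "a \<in> Tate_1" "b \<in> Tate_1"
  shows "a + b \<in> Tate_1"
  unfolding Tate_1_iff fps_add_nth
proof
  fix k
  have "\<forall>\<^sub>F m in sequentially. 2 ^ Suc k dvd fps_nth a m"
    "\<forall>\<^sub>F m in sequentially. 2 ^ Suc k dvd fps_nth b m"
    using assms unfolding Tate_1_iff by blast+
  then show "\<forall>\<^sub>F m in sequentially. 2 ^ Suc k dvd fps_nth a m + fps_nth b m"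
    by eventually_elim (rule dvd_add)
qed

lemma Tate_1_uminus: "a \<in> Tate_1 \<Longrightarrow> - a \<in> Tate_1"
  by (simp add: Tate_1_iff)

lemma Tate_1_0: "0 \<in> Tate_1"
  by (simp add: Tate_1_iff)

lemma add_group_simps [simp]:
  "carrier (add_group A) = A" "x \<otimes>\<^bsub>add_group A\<^esub> y = x + y" "\<one>\<^bsub>add_group A\<^esub> = 0"
  by (simp_all add: add_group_def)

text \<open>Used at the end to invert an isomorphism that starts at this group.\<close>

lemma group_Tate_1: "group (add_group Tate_1)"
proof (rule groupI)
  fix a
  assume "a \<in> carrier (add_group Tate_1)"
  then show "\<exists>b\<in>carrier (add_group Tate_1). b \<otimes>\<^bsub>add_group Tate_1\<^esub> a = \<one>\<^bsub>add_group Tate_1\<^esub>"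
    by (auto intro!: bexI[of _ "- a"] Tate_1_uminus)
qed (auto simp: Tate_1_add Tate_1_0 add.assoc)

text \<open>The keys are finite and distinct \<open>m\<close> give distinct monomials, so only
  finitely many \<open>m\<close> hit a key.\<close>

lemma eventually_lookup_eq_0:
  "\<forall>\<^sub>F m in sequentially. Poly_Mapping.lookup f (Poly_Mapping.single (0::nat) (m::nat)) = 0"
proof -
  have "inj (\<lambda>m::nat. Poly_Mapping.single (0::nat) m)"
    by (rule injI) (metis lookup_single_eq)
  then have "finite ((\<lambda>m. Poly_Mapping.single 0 m) -` Poly_Mapping.keys f)"
    by (intro finite_vimageI) simp_all
  then show ?thesis
    unfolding cofinite_eq_sequentially[symmetric] eventually_cofinite
    by (simp add: vimage_def in_keys_iff)
qed

lemma to_Tate_1_in: "to_Tate_1 f \<in> Tate_1"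
  unfolding Tate_1_iff to_Tate_1_def
  by (auto intro: eventually_mono[OF eventually_lookup_eq_0[of f]])

section \<open>Polynomial approximations of a power series\<close>

text \<open>For \<open>a\<close> in \<open>Tate_1\<close>, the function \<open>poly_approx a\<close>
  is the point of the completion belonging to \<open>a\<close>: its value at \<open>k\<close> is a
  coset of \<open>L_sub k\<close>, described without choosing a representative.\<close>

definition poly_approx :: "dyadic fps \<Rightarrow> nat \<Rightarrow> dyadic mpoly set"
  where "poly_approx a k =
    {f \<in> mpolys 1. \<forall>m. 2 ^ Suc k dvd Poly_Mapping.lookup f (Poly_Mapping.single 0 m) - fps_nth a m}"

text \<open>Here the Tate condition enters: the series is cut off where all later coefficients are
  divisible by \<open>2 ^ Suc k\<close>.\<close>

lemma poly_approx_nonempty: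
  assumes "a \<in> Tate_1"
  obtains f where "f \<in> poly_approx a k"
proof -
  obtain N where N: "\<And>m. N \<le> m \<Longrightarrow> 2 ^ Suc k dvd fps_nth a m"
    using assms unfolding Tate_1_iff eventually_sequentially by blast
  let ?f = "(\<Sum>m<N. Poly_Mapping.single (Poly_Mapping.single 0 m) (fps_nth a m)) :: dyadic mpoly"
  have [simp]: "Poly_Mapping.single (0::nat) i = Poly_Mapping.single 0 m \<longleftrightarrow> i = m" for i m :: nat
    by (metis lookup_single_eq)
  have "Poly_Mapping.lookup ?f (Poly_Mapping.single 0 m) = (if m < N then fps_nth a m else 0)"
    for m by (simp add: lookup_sum lookup_single when_def)
  moreover have "?f \<in> mpolys 1" by (intro mpolys_sum) (simp add: mpolys_def)
  ultimately have "?f \<in> poly_approx a k" using N by (simp add: poly_approx_def)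
  then show thesis by (rule that)
qed

lemma poly_approx_diff:
  assumes "f \<in> poly_approx a k" "g \<in> poly_approx b k"
  shows "f - g \<in> poly_approx (a - b) k"
proof -
  have *: "x - y - (c - d) = (x - c) - (y - d)" for x y c d :: dyadic by simp
  then show ?thesis
    using assms by (auto simp: poly_approx_def mpolys_diff lookup_minus * intro: dvd_diff
        simp del: power_Suc)
qed

lemma poly_approx_add:
  assumes "f \<in> poly_approx a k" "g \<in> poly_approx b k"
  shows "f + g \<in> poly_approx (a + b) k"
proof -
  have *: "x + y - (c + d) = (x - c) + (y - d)" for x y c d :: dyadic by simp
  then show ?thesis
    using assms by (auto simp: poly_approx_def mpolys_add lookup_add * intro: dvd_add
        simp del: power_Suc)
qed

lemma poly_approx_Suc: "f \<in> poly_approx a (Suc k) \<Longrightarrow> f \<in> poly_approx a k"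
  unfolding poly_approx_def using le_imp_power_dvd[of "Suc k" "Suc (Suc k)" "2 :: dyadic"]
  by (auto intro: dvd_trans simp del: power_Suc)

lemma L_sub_eq_poly_approx: "L_sub k = poly_approx 0 k"
  by (auto simp: poly_approx_def L_sub_iff simp del: power_Suc)

text \<open>The product of cosets is their elementwise sum. For the second inclusion any
  approximation \<open>g\<close> of \<open>a\<close> splits \<open>f\<close> as
  \<open>g + (f - g)\<close>.\<close>

lemma poly_approx_set_mult:
  assumes "a \<in> Tate_1" "b \<in> Tate_1"
  shows "poly_approx a k <#>\<^bsub>poly1\<^esub> poly_approx b k = poly_approx (a + b) k"
proof
  show "poly_approx a k <#>\<^bsub>poly1\<^esub> poly_approx b k \<subseteq> poly_approx (a + b) k"
    by (auto simp: set_mult_def poly_approx_add)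
  show "poly_approx (a + b) k \<subseteq> poly_approx a k <#>\<^bsub>poly1\<^esub> poly_approx b k"
  proof
    fix f
    assume f: "f \<in> poly_approx (a + b) k"
    obtain g where g: "g \<in> poly_approx a k" using poly_approx_nonempty[OF assms(1)] .
    have "f - g \<in> poly_approx b k" using poly_approx_diff[OF f g] by simp
    then show "f \<in> poly_approx a k <#>\<^bsub>poly1\<^esub> poly_approx b k"
      using g unfolding set_mult_def add_group_simps
      by (intro UN_I[of g] UN_I[of "f - g"]) simp_all
  qed
qed

text \<open>An approximation at level \<open>k\<close> differs from any finer one by an
  approximation of 0, that is, by an element of \<open>L_sub k\<close>.\<close>

lemma poly_approx_compatible:
  assumes "a \<in> Tate_1"
  shows "L_sub k <#>\<^bsub>poly1\<^esub> poly_approx a (Suc k) = poly_approx a k"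
proof
  show "L_sub k <#>\<^bsub>poly1\<^esub> poly_approx a (Suc k) \<subseteq> poly_approx a k"
    using poly_approx_add[of _ 0 k _ a]
    by (auto simp: set_mult_def L_sub_eq_poly_approx poly_approx_Suc)
  show "poly_approx a k \<subseteq> L_sub k <#>\<^bsub>poly1\<^esub> poly_approx a (Suc k)"
  proof
    fix f
    assume f: "f \<in> poly_approx a k"
    obtain g where g: "g \<in> poly_approx a (Suc k)" using poly_approx_nonempty[OF assms] .
    have "f - g \<in> L_sub k"
      using poly_approx_diff[OF f poly_approx_Suc[OF g]] by (simp add: L_sub_eq_poly_approx)
    then show "f \<in> L_sub k <#>\<^bsub>poly1\<^esub> poly_approx a (Suc k)"
      using g unfolding set_mult_def add_group_simps
      by (intro UN_I[of "f - g"] UN_I[of g]) simp_all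
  qed
qed

lemma poly_approx_eq_coset:
  assumes "f \<in> poly_approx a k"
  shows "poly_approx a k = L_sub k #>\<^bsub>poly1\<^esub> f"
proof
  show "poly_approx a k \<subseteq> L_sub k #>\<^bsub>poly1\<^esub> f"
  proof
    fix g
    assume "g \<in> poly_approx a k"
    then have "g - f \<in> L_sub k"
      using poly_approx_diff[OF _ assms] by (fastforce simp: L_sub_eq_poly_approx)
    then show "g \<in> L_sub k #>\<^bsub>poly1\<^esub> f"
      by (auto simp: r_coset_def intro!: bexI[of _ "g - f"])
  qed
  show "L_sub k #>\<^bsub>poly1\<^esub> f \<subseteq> poly_approx a k"
    using poly_approx_add[OF _ assms, of _ 0] by (auto simp: r_coset_def L_sub_eq_poly_approx)
qed

text \<open>A polynomial approximates its own series at every level, so it represents all the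
  cosets.\<close>

lemma poly_approx_to_Tate_1:
  "f \<in> mpolys 1 \<Longrightarrow> poly_approx (to_Tate_1 f) = to_L_completion f"
  unfolding to_L_completion_def
  by (intro ext poly_approx_eq_coset) (simp add: poly_approx_def to_Tate_1_def)

lemma poly_approx_inject:
  assumes "a \<in> Tate_1" "poly_approx a = poly_approx b"
  shows "a = b"
proof (rule fps_ext, rule dyadic_eqI)
  fix m k
  obtain f where "f \<in> poly_approx a k" using poly_approx_nonempty[OF assms(1)] .
  \<comment> \<open>A common approximation \<open>f\<close> is subtracted from itself, which makes
    \<open>a - b\<close> divisible by \<open>2 ^ Suc k\<close> coefficientwise.\<close>
  then have "0 \<in> poly_approx (a - b) k" using poly_approx_diff[of f a k f b] assms(2) by simp
  then have "2 ^ Suc k dvd - (fps_nth a m - fps_nth b m)"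
    by (simp add: poly_approx_def del: power_Suc)
  then show "2 ^ Suc k dvd fps_nth a m - fps_nth b m" by (simp only: dvd_minus_iff)
qed

section \<open>The isomorphism with the completion\<close>

lemma L_completion_carrier:
  "x \<in> carrier L_completion \<longleftrightarrow>
    (\<forall>k. (\<exists>f\<in>mpolys 1. x k = L_sub k #>\<^bsub>poly1\<^esub> f) \<and> L_sub k <#>\<^bsub>poly1\<^esub> x (Suc k) = x k)"
  by (auto simp: L_completion_def inverse_limit_def FactGroup_def RCOSETS_def)

lemma poly_approx_in_L_completion:
  assumes "a \<in> Tate_1"
  shows "poly_approx a \<in> carrier L_completion"
  unfolding L_completion_carrier
proof (intro allI conjI poly_approx_compatible[OF assms])
  fix k
  obtain f where f: "f \<in> poly_approx a k" using poly_approx_nonempty[OF assms] .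
  then have "f \<in> mpolys 1" by (simp add: poly_approx_def)
  then show "\<exists>f\<in>mpolys 1. poly_approx a k = L_sub k #>\<^bsub>poly1\<^esub> f"
    using poly_approx_eq_coset[OF f] by blast
qed

text \<open>Representatives \<open>f k\<close> of the cosets have coefficients that converge
  dyadically as \<open>k\<close> grows; the limits are the coefficients of the required
  series.\<close>

lemma poly_approx_surj:
  assumes "x \<in> carrier L_completion"
  obtains a where "a \<in> Tate_1" "x = poly_approx a"
proof -
  have "\<forall>k. \<exists>f. f \<in> mpolys 1 \<and> x k = L_sub k #>\<^bsub>poly1\<^esub> f"
    using assms unfolding L_completion_carrier by blast
  from choice[OF this] obtain f
    where f: "\<And>k. f k \<in> mpolys 1" "\<And>k. x k = L_sub k #>\<^bsub>poly1\<^esub> f k"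
    by blast
  have x: "x k = poly_approx (to_Tate_1 (f k)) k" for k
    using f poly_approx_to_Tate_1[of "f k"] by (simp add: to_L_completion_def)
  let ?c = "\<lambda>k m. Poly_Mapping.lookup (f k) (Poly_Mapping.single 0 m)"
  have "\<exists>a. \<forall>k. 2 ^ Suc k dvd a - ?c k m" for m
  proof (rule dyadic_complete[of "\<lambda>k. ?c k m"])
    fix k
    have "f (Suc k) \<in> x (Suc k)" by (simp add: x poly_approx_def to_Tate_1_def f(1) del: One_nat_def)
    \<comment> \<open>Adding 0 shows that \<open>x (Suc k)\<close> is contained in its projection
      \<open>x k\<close>, so \<open>f (Suc k)\<close> and \<open>f k\<close> lie in one
      coset.\<close>
    moreover have "0 \<in> L_sub k" by (simp add: L_sub_iff)
    ultimately have "f (Suc k) \<in> L_sub k <#>\<^bsub>poly1\<^esub> x (Suc k)"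
      unfolding set_mult_def add_group_simps by (intro UN_I[of 0] UN_I[of "f (Suc k)"]) simp_all
    then have "f (Suc k) \<in> x k" using assms by (simp add: L_completion_carrier)
    then show "2 ^ Suc k dvd ?c (Suc k) m - ?c k m"
      by (simp add: x poly_approx_def to_Tate_1_def del: power_Suc)
  qed blast
  then have "\<forall>m. \<exists>a. \<forall>k. 2 ^ Suc k dvd a - ?c k m" by blast
  from choice[OF this] obtain c where c: "\<And>k m. 2 ^ Suc k dvd c m - ?c k m" by blast
  let ?a = "Abs_fps c"
  have "2 ^ Suc k dvd ?c k m - c m" for k m
    using c[of k m] by (metis dvd_minus_iff minus_diff_eq)
  then have fa: "f k \<in> poly_approx ?a k" for k
    using f(1)[of k] by (simp add: poly_approx_def del: power_Suc One_nat_def)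
  \<comment> \<open>For each \<open>k\<close>, almost all coefficients of \<open>f k\<close> vanish,
    and those of \<open>?a\<close> are congruent to them modulo \<open>2 ^ Suc k\<close>.\<close>
  have "?a \<in> Tate_1"
    unfolding Tate_1_iff
  proof
    fix k
    show "\<forall>\<^sub>F m in sequentially. 2 ^ Suc k dvd fps_nth ?a m"
      using eventually_lookup_eq_0[of "f k"]
    proof eventually_elim
      case (elim m)
      then show ?case using c[of k m] by simp
    qed
  qed
  moreover have "x = poly_approx ?a"
    using poly_approx_eq_coset[OF fa] f(2) by (intro ext) simp
  ultimately show thesis by (rule that)
qed

text \<open>This direction is explicit, whereas a map out of the completion would require choosing
  representatives and taking limits.\<close>

lemma poly_approx_iso: "poly_approx \<in> iso (add_group Tate_1) L_completion"
proof (rule isoI)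
  show "poly_approx \<in> hom (add_group Tate_1) L_completion"
  proof (rule homI)
    fix a b
    assume "a \<in> carrier (add_group Tate_1)" "b \<in> carrier (add_group Tate_1)"
    then show "poly_approx (a \<otimes>\<^bsub>add_group Tate_1\<^esub> b)
        = poly_approx a \<otimes>\<^bsub>L_completion\<^esub> poly_approx b"
      by (intro ext)
        (simp add: L_completion_def inverse_limit_def FactGroup_def poly_approx_set_mult
          del: One_nat_def)
  qed (simp add: poly_approx_in_L_completion)
  show "bij_betw poly_approx (carrier (add_group Tate_1)) (carrier L_completion)"
    unfolding bij_betw_def add_group_simps
  proof
    show "inj_on poly_approx Tate_1" using poly_approx_inject by (rule inj_onI)
    show "poly_approx ` Tate_1 = carrier L_completion"
      using poly_approx_in_L_completion poly_approx_surj by blast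
  qed
qed

theorem theorem5p9:
  shows "\<exists>\<phi> \<in> iso L_completion (add_group Tate_1).
    \<forall>f \<in> mpolys 1. \<phi> (to_L_completion f) = to_Tate_1 f"
proof
  \<comment> \<open>Since \<open>to_L_completion f\<close> equals
    \<open>poly_approx (to_Tate_1 f)\<close>, the inverse automatically extends the inclusion of
    polynomials.\<close>
  let ?\<phi> = "inv_into Tate_1 poly_approx"
  show "?\<phi> \<in> iso L_completion (add_group Tate_1)"
    using group.iso_set_sym[OF group_Tate_1 poly_approx_iso] by simp
  have "inj_on poly_approx Tate_1" using poly_approx_inject by (rule inj_onI)
  then show "\<forall>f\<in>mpolys 1. ?\<phi> (to_L_completion f) = to_Tate_1 f"
    using to_Tate_1_in by (simp add: poly_approx_to_Tate_1[symmetric])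
qed

end
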